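(* Let $\mathcal{V}$ be a Euclidean Jordan algebra of rank $n$, fix a Jordan frame $\{e_1,\dots,e_n\}$ in $\mathcal{V}$, and suppose $A=[a_{ij}]\in\mathbb{R}^{n\times n}$ is a nonnegative matrix. Let $\widehat{A}:=\sum_{i,j=1}^{n}a_{ij}\,e_i\otimes e_j$. Then $\widehat{A}\in\mathbf{Q}(\mathcal{V})$ if and only if the diagonal of $A$ is positive. Consequently, $\widehat{A}\in\mathbf{Q}(\mathcal{V})\Leftrightarrow A\in\mathbf{Q}(\mathbb{R}^n)$.
   Context: A Euclidean Jordan algebra is a (nonzero) finite-dimensional real inner product space $(\mathcal{V},\langle\cdot,\cdot\rangle)$ with a bilinear product $(x,y)\mapsto x\circ y$ satisfying $x\circ y=y\circ x$, $x\circ(x^2\circ y)=x^2\circ(x\circ y)$ where $x^2=x\circ x$, and $\langle x\circ y,z\rangle=\langle x,y\circ z\rangle$; it has a unit element $e$. The inner product is taken to be $\langle x,y\rangle=\mathrm{trace}(x\circ y)$, where the trace of an element is the sum of its eigenvalues (from its spectral decomposition). A Jordan frame is a set of mutually orthogonal primitive idempotents with sum $e$; all Jordan frames have the same number of elements, the rank of $\mathcal{V}$. The symmetric cone is $\mathcal{V}_+=\{x\circ x:x\in\mathcal{V}\}$. For $a,b\in\mathcal{V}$, $(a\otimes b)(x):=\langle b,x\rangle\,a$; thus $\widehat{A}x=\sum_{i}\big(\sum_{j}a_{ij}\langle x,e_j\rangle\big)e_i$. For a linear $L:\mathcal{V}\to\mathcal{V}$ and $q\in\mathcal{V}$, $\mathrm{LCP}(L,\mathcal{V}_+,q)$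 is the problem of finding $x\in\mathcal{V}_+$ with $y:=L(x)+q\in\mathcal{V}_+$ and $\langle x,y\rangle=0$. $L\in\mathbf{Q}(\mathcal{V})$ if this has a solution for every $q\in\mathcal{V}$. $A\in\mathbf{Q}(\mathbb{R}^n)$ if for every $q\in\mathbb{R}^n$ there is $x\in\mathbb{R}^n$ with $x\ge 0$, $Ax+q\ge 0$, $x^\top(Ax+q)=0$ (componentwise inequalities). A matrix is nonnegative if all its entries are nonnegative. *)

theory Defs
  imports "HOL-Analysis.Analysis"
begin

locale euclidean_jordan_algebra =
  fixes mul :: "'a::euclidean_space \<Rightarrow> 'a \<Rightarrow> 'a" and e :: 'a
  assumes bilinear_mul: "bilinear mul"
    and mul_commute: "mul x y = mul y x"
    and jordan_identity: "mul x (mul (mul x x) y) = mul (mul x x) (mul x y)"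
    and inner_mul: "inner (mul x y) z = inner x (mul y z)"
    and mul_unit: "mul x e = x"

definition idempotent :: "('a \<Rightarrow> 'a \<Rightarrow> 'a) \<Rightarrow> 'a \<Rightarrow> bool" where
  "idempotent mul c \<longleftrightarrow> mul c c = c"

definition primitive_idempotent :: "('a::real_vector \<Rightarrow> 'a \<Rightarrow> 'a) \<Rightarrow> 'a \<Rightarrow> bool" where
  "primitive_idempotent mul c \<longleftrightarrow> idempotent mul c \<and> c \<noteq> 0 \<and>
     \<not> (\<exists>a b. idempotent mul a \<and> idempotent mul b \<and> a \<noteq> 0 \<and> b \<noteq> 0 \<and> c = a + b)"

text \<open>Orthogonality of idempotents is \<open>mul c d = 0\<close>; in a Euclidean Jordan algebra this
  implies \<open>inner c d = inner (mul c d) e = 0\<close>.\<close>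

definition jordan_frame :: "('a::real_vector \<Rightarrow> 'a \<Rightarrow> 'a) \<Rightarrow> 'a \<Rightarrow> 'a set \<Rightarrow> bool" where
  "jordan_frame mul e F \<longleftrightarrow> finite F \<and> (\<forall>c\<in>F. primitive_idempotent mul c) \<and>
     (\<forall>c\<in>F. \<forall>d\<in>F. c \<noteq> d \<longrightarrow> mul c d = 0) \<and> (\<Sum>c\<in>F. c) = e"

text \<open>The next two definitions rely on the classical facts that all Jordan frames of a Euclidean
  Jordan algebra have the same number of elements, that every element has a spectral decomposition
  \<open>x = (\<Sum>c\<in>F. ev c *\<^sub>R c)\<close> along some Jordan frame \<open>F\<close>, and that
  the eigenvalues \<open>ev c\<close>, counted with multiplicity, do not depend on the choice of \<open>F\<close>.\<close>

definition jordan_rank :: "('a::real_vector \<Rightarrow> 'a \<Rightarrow> 'a) \<Rightarrow> 'a \<Rightarrow> nat" where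
  "jordan_rank mul e = (THE n. \<exists>F. jordan_frame mul e F \<and> card F = n)"

definition jordan_trace :: "('a::real_vector \<Rightarrow> 'a \<Rightarrow> 'a) \<Rightarrow> 'a \<Rightarrow> 'a \<Rightarrow> real" where
  "jordan_trace mul e x = (THE t. \<exists>F ev. jordan_frame mul e F \<and>
     x = (\<Sum>c\<in>F. ev c *\<^sub>R c) \<and> t = (\<Sum>c\<in>F. ev c))"

definition symmetric_cone :: "('a \<Rightarrow> 'a \<Rightarrow> 'a) \<Rightarrow> 'a set" where
  "symmetric_cone mul = {mul x x | x. True}"

definition outer :: "'a::real_inner \<Rightarrow> 'a \<Rightarrow> 'a \<Rightarrow> 'a" where
  "outer a b x = inner b x *\<^sub>R a"

definition frame_operator :: "('n::finite \<Rightarrow> 'a::real_inner) \<Rightarrow> real^'n^'n \<Rightarrow> 'a \<Rightarrow> 'a" where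
  "frame_operator c A x = (\<Sum>i\<in>UNIV. \<Sum>j\<in>UNIV. A $ i $ j *\<^sub>R outer (c i) (c j) x)"

definition lcp_solution :: "('a::real_inner \<Rightarrow> 'a) \<Rightarrow> 'a set \<Rightarrow> 'a \<Rightarrow> 'a \<Rightarrow> bool" where
  "lcp_solution L K q x \<longleftrightarrow> x \<in> K \<and> L x + q \<in> K \<and> inner x (L x + q) = 0"

definition Q_operators :: "('a::real_inner \<Rightarrow> 'a \<Rightarrow> 'a) \<Rightarrow> ('a \<Rightarrow> 'a) set" where
  "Q_operators mul = {L. linear L \<and> (\<forall>q. \<exists>x. lcp_solution L (symmetric_cone mul) q x)}"

definition Q_matrices :: "(real^'n^'n) set" where
  "Q_matrices = {A. \<forall>q. \<exists>x. (\<forall>i. 0 \<le> x $ i) \<and> (\<forall>i. 0 \<le> (A *v x + q) $ i) \<and>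
     inner x (A *v x + q) = 0}"

end

theory Submission imports Defs begin

text \<open>For \<open>x\<close> in the symmetric cone put \<open>s\<^sub>i = \<langle>c\<^sub>i, x\<rangle> \<ge> 0\<close>. If the diagonal of \<open>A\<close> is positive, then
  \<open>\<langle>Ax, x\<rangle> = \<Sum> a\<^sub>i\<^sub>j s\<^sub>i s\<^sub>j\<close> dominates a positive multiple of \<open>(\<Sum> s\<^sub>i)\<^sup>2 = \<langle>e, x\<rangle>\<^sup>2\<close>, so the operator is strictly
  copositive, and a Brouwer fixed point on a truncation of the cone solves the complementarity
  problem with respect to the dual cone. That this is the cone itself follows from the spectral
  decomposition and from the positivity of multiplication by an idempotent. Conversely, for
  \<open>q = e - 2c\<^sub>k\<close> complementarity forces \<open>s\<^sub>i = 0\<close> for \<open>i \<noteq> k\<close> and then \<open>a\<^sub>k\<^sub>k s\<^sub>k \<ge> 1\<close>. The argument for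
  \<open>\<real>\<^sup>n\<close> is the same.\<close>

section \<open>Eigenvectors of self-adjoint operators\<close>

text \<open>The Rayleigh quotient attains its maximum \<open>m\<close> on the unit sphere of
  \<open>W\<close>. At a maximizer the residual \<open>L u - m *\<^sub>R u\<close> stays in
  \<open>W\<close> by invariance and must vanish by optimality.\<close>

lemma eigenvector_self_adjoint_on_subspace:
  fixes L :: "'a::euclidean_space \<Rightarrow> 'a"
  assumes L: "linear L" and W: "subspace W" "W \<noteq> {0}"
    and inv: "\<And>v. v \<in> W \<Longrightarrow> L v \<in> W"
    and sa: "\<And>u v. inner (L u) v = inner u (L v)"
  obtains u l where "u \<in> W" "u \<noteq> 0" "L u = l *\<^sub>R u"
proof -
  let ?S = "sphere 0 1 \<inter> W"
  obtain w where w: "w \<in> W" "w \<noteq> 0"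
    using W subspace_0 by blast
  have "w /\<^sub>R norm w \<in> ?S"
    using w W by (simp add: subspace_scale)
  moreover have "compact ?S"
    using W by (intro compact_Int_closed compact_sphere closed_subspace)
  moreover have "continuous_on ?S (\<lambda>u. inner (L u) u)"
    by (intro continuous_intros linear_continuous_on linear_conv_bounded_linear[THEN iffD1] L)
  ultimately obtain u where u: "u \<in> ?S" and max: "\<And>v. v \<in> ?S \<Longrightarrow> inner (L v) v \<le> inner (L u) u"
    using continuous_attains_sup[of ?S "\<lambda>u. inner (L u) u"] by blast
  define m where "m = inner (L u) u"
  have uu: "inner u u = 1"
    using u by (simp add: norm_eq_1)
  have le: "inner (L v) v \<le> m * inner v v" if "v \<in> W" for v
  proof (cases "v = 0")
    case False
    have "inner (L (v /\<^sub>R norm v)) (v /\<^sub>R norm v) \<le> m"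
      unfolding m_def using that False W by (intro max) (simp add: subspace_scale)
    then show ?thesis
      using False by (simp add: linear_cmul[OF L] field_simps power2_norm_eq_inner[symmetric] power2_eq_square)
  qed (simp add: linear_0[OF L])
  define d where "d = L u - m *\<^sub>R u"
  have d: "d \<in> W"
    unfolding d_def using W u inv by (simp add: subspace_diff subspace_scale)
  \<comment> \<open>First-order optimality of \<open>u\<close> along the residual \<open>d\<close>.\<close>
  have key: "2 * t * inner d d \<le> t\<^sup>2 * (m * inner d d - inner (L d) d)" for t
  proof -
    have "inner (L (u + t *\<^sub>R d)) (u + t *\<^sub>R d) \<le> m * inner (u + t *\<^sub>R d) (u + t *\<^sub>R d)"
      using u d W by (intro le) (simp add: subspace_add subspace_scale)
    then have "2 * t * (inner (L u) d - m * inner u d) \<le> t\<^sup>2 * (m * inner d d - inner (L d) d)"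
      using sa[of d u] uu
      by (simp add: linear_cmul[OF L] linear_add[OF L] inner_add_left inner_add_right
          inner_commute m_def power2_eq_square algebra_simps)
    then show ?thesis
      by (simp add: d_def inner_diff_left)
  qed
  have "inner d d = 0"
  proof (rule ccontr)
    assume "inner d d \<noteq> 0"
    then have p: "inner d d > 0" by simp
    \<comment> \<open>For small \<open>t\<close> the linear term in \<open>key\<close> beats the
      quadratic one; this choice gives \<open>t * C \<le> inner d d\<close>, and the 1 covers
      \<open>C = 0\<close>.\<close>
    define C where "C = m * inner d d - inner (L d) d"
    define t where "t = inner d d / (1 + \<bar>C\<bar>)"
    have t: "t > 0" using p by (simp add: t_def add_pos_nonneg)
    have "2 * t * inner d d \<le> t\<^sup>2 * C" using key[of t] by (simp add: C_def)
    then have "2 * inner d d \<le> t * C" using t by (simp add: power2_eq_square)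
    also have "t * C \<le> t * (1 + \<bar>C\<bar>)" using t by (intro mult_left_mono) auto
    also have "\<dots> = inner d d" by (simp add: t_def)
    finally show False using p by simp
  qed
  then have "L u = m *\<^sub>R u" by (simp add: d_def)
  moreover have "u \<in> W" "u \<noteq> 0" using u by auto
  ultimately show ?thesis using that by blast
qed

section \<open>Complementarity over a closed convex cone\<close>

text \<open>Cutting \<open>K\<close> by a level of \<open>h\<close> gives a compact convex set, on
  which Brouwer's theorem solves a variational inequality. Strict copositivity keeps the solution
  off the cut face, so the inequality spreads to all of \<open>K\<close>.\<close>

lemma strictly_copositive_complementarity:
  fixes L :: "'a::euclidean_space \<Rightarrow> 'a"
  assumes L: "linear L" and K: "closed K" "convex K" "cone K" "K \<noteq> {}"
    and bound: "\<And>x. x \<in> K \<Longrightarrow> norm x \<le> B * inner h x"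
    and pos: "\<And>x. x \<in> K \<Longrightarrow> 0 \<le> inner h x"
    and cop: "\<And>x. x \<in> K \<Longrightarrow> \<delta> * (inner h x)\<^sup>2 \<le> inner (L x) x" and \<delta>: "\<delta> > 0"
  obtains x where "x \<in> K" "\<And>z. z \<in> K \<Longrightarrow> 0 \<le> inner (L x + q) z" "inner x (L x + q) = 0"
proof -
  \<comment> \<open>The quotient is the bound that copositivity imposes on \<open>inner h x\<close>
    at the fixed point; the extra 1 makes it strict and \<open>r\<close> positive.\<close>
  define r where "r = \<bar>norm q * B\<bar> / \<delta> + 1"
  define S where "S = K \<inter> {x. inner h x \<le> r}"
  have r: "r > 0" using \<delta> by (simp add: r_def add_nonneg_pos)
  have K0: "0 \<in> K" using K cone_contains_0 by blast
  have scale: "t *\<^sub>R x \<in> K" if "x \<in> K" "0 \<le> t" for x t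
    using K(3) that by (simp add: cone_def)
  have add: "x + y \<in> K" if "x \<in> K" "y \<in> K" for x y
    using K(2,3) that convex_cone[of K] by blast
  have S0: "0 \<in> S" using K0 r by (simp add: S_def)
  have "norm x \<le> \<bar>B\<bar> * r" if "x \<in> S" for x
  proof -
    have "norm x \<le> B * inner h x" using that bound by (simp add: S_def)
    also have "\<dots> \<le> \<bar>B\<bar> * r"
      using that pos[of x] by (intro mult_mono) (auto simp: S_def)
    finally show ?thesis .
  qed
  then have "bounded S" by (auto simp: bounded_iff)
  moreover have closedS: "closed S"
    unfolding S_def by (intro closed_Int K closed_halfspace_le)
  ultimately have comp: "compact S" by (simp add: compact_eq_bounded_closed)
  have conv: "convex S"
    unfolding S_def by (intro convex_Int K convex_halfspace_le)
  \<comment> \<open>A fixed point of this projected step solves the variational inequality for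
    \<open>L x + q\<close> on \<open>S\<close>.\<close>
  let ?g = "\<lambda>x. closest_point S (x - (L x + q))"
  have "continuous_on S (\<lambda>x. x - (L x + q))"
    by (intro continuous_intros linear_continuous_on linear_conv_bounded_linear[THEN iffD1] L)
  then have "continuous_on S ?g"
    using S0 by (intro continuous_on_compose2[OF continuous_on_closest_point[OF conv closedS, of UNIV]]) auto
  moreover have "?g \<in> S \<rightarrow> S"
    using closest_point_in_set[OF closedS] S0 by blast
  ultimately obtain x where x: "x \<in> S" "?g x = x"
    using brouwer[OF comp conv] S0 by blast
  define y where "y = L x + q"
  have VI: "0 \<le> inner y (z - x)" if "z \<in> S" for z
    using closest_point_dot[OF conv closedS that, of "x - y"] x
    by (simp add: y_def[symmetric] inner_diff_left)
  have yx: "inner y x \<le> 0" using VI[OF S0] by simp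
  have xK: "x \<in> K" using x by (simp add: S_def)
  have strict: "inner h x < r"
  proof (cases "inner h x = 0")
    case False
    then have hx: "inner h x > 0" using pos[OF xK] by simp
    have "\<delta> * (inner h x)\<^sup>2 \<le> inner (L x) x" by (rule cop[OF xK])
    also have "\<dots> \<le> - inner q x" using yx by (simp add: y_def inner_add_left)
    also have "\<dots> \<le> norm q * norm x" using Cauchy_Schwarz_ineq2[of q x] by simp
    also have "\<dots> \<le> norm q * (B * inner h x)" by (intro mult_left_mono bound xK) simp
    also have "\<dots> \<le> \<bar>norm q * B\<bar> * inner h x" using hx by (simp add: mult.assoc[symmetric])
    finally have "\<delta> * inner h x \<le> \<bar>norm q * B\<bar>" using hx by (simp add: power2_eq_square)
    then have "inner h x \<le> \<bar>norm q * B\<bar> / \<delta>" using \<delta> by (simp add: field_simps)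
    then show ?thesis by (simp add: r_def)
  qed (use r in simp)
  have dual: "0 \<le> inner y z" if z: "z \<in> K" for z
  proof -
    \<comment> \<open>A step of this length in direction \<open>z\<close> stays below the cut; the 1
      in the denominator covers \<open>inner h z = 0\<close>.\<close>
    define t where "t = (r - inner h x) / (1 + inner h z)"
    have pz: "0 < 1 + inner h z" using pos[OF z] by simp
    have t: "t > 0" using strict pz by (simp add: t_def)
    have "t * inner h z \<le> t * (1 + inner h z)" using t by simp
    also have "\<dots> = r - inner h x" using pz by (simp add: t_def)
    finally have "x + t *\<^sub>R z \<in> S"
      using t z xK add scale by (simp add: S_def inner_add_right)
    from VI[OF this] show ?thesis using t by (simp add: zero_le_mult_iff)
  qed
  have "inner x y = 0" using dual[OF xK] yx by (simp add: inner_commute)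
  then show ?thesis using that[of x] xK dual by (simp add: y_def)
qed

section \<open>Nonnegative matrices with positive diagonal\<close>

text \<open>Dropping the off-diagonal terms leaves at least the least diagonal entry
  \<open>m\<close> times the sum of squares; Cauchy-Schwarz then costs the factor
  \<open>CARD('n)\<close>. The family \<open>s\<close> will be the coordinates of a vector or the
  pairings with a Jordan frame.\<close>

lemma positive_diagonal_copositive:
  fixes A :: "real^'n^'n"
  assumes "\<forall>i j. 0 \<le> A $ i $ j" "\<forall>i. 0 < A $ i $ i"
  obtains \<delta> where "\<delta> > 0" and
    "\<And>s. (\<And>i. 0 \<le> s i) \<Longrightarrow> \<delta> * (\<Sum>i\<in>UNIV. s i)\<^sup>2 \<le> (\<Sum>i\<in>UNIV. \<Sum>j\<in>UNIV. A $ i $ j * s j * s i)"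
proof -
  define m where "m = Min (range (\<lambda>i. A $ i $ i))"
  have "m \<in> range (\<lambda>i. A $ i $ i)" unfolding m_def by (intro Min_in) auto
  then have m: "m > 0" using assms by auto
  have mle: "m \<le> A $ i $ i" for i unfolding m_def by (intro Min_le) auto
  have "m / CARD('n) * (\<Sum>i\<in>UNIV. s i)\<^sup>2 \<le> (\<Sum>i\<in>UNIV. \<Sum>j\<in>UNIV. A $ i $ j * s j * s i)"
    if s: "\<And>i. 0 \<le> s i" for s :: "'n \<Rightarrow> real"
  proof -
    have "(\<Sum>i\<in>UNIV. s i)\<^sup>2 \<le> CARD('n) * (\<Sum>i\<in>UNIV. (s i)\<^sup>2)"
      using sum_squared_le_sum_of_squares[of s UNIV] by (simp add: mult.commute)
    then have "m / CARD('n) * (\<Sum>i\<in>UNIV. s i)\<^sup>2 \<le> m / CARD('n) * (CARD('n) * (\<Sum>i\<in>UNIV. (s i)\<^sup>2))"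
      using m by (intro mult_left_mono) auto
    also have "\<dots> = (\<Sum>i\<in>UNIV. m * s i * s i)"
      by (simp add: sum_distrib_left power2_eq_square mult.assoc)
    also have "\<dots> \<le> (\<Sum>i\<in>UNIV. \<Sum>j\<in>UNIV. A $ i $ j * s j * s i)"
    proof (rule sum_mono)
      fix i
      have "m * s i * s i \<le> A $ i $ i * s i * s i" using mle s by (intro mult_right_mono) auto
      also have "\<dots> \<le> (\<Sum>j\<in>UNIV. A $ i $ j * s j * s i)"
        using assms s by (intro member_le_sum) auto
      finally show "m * s i * s i \<le> (\<Sum>j\<in>UNIV. A $ i $ j * s j * s i)" .
    qed
    finally show ?thesis .
  qed
  moreover have "m / CARD('n) > 0" using m by simp
  ultimately show ?thesis using that by blast
qed

lemma nonneg_Q_matrices_iff: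
  fixes A :: "real^'n^'n"
  assumes A: "\<forall>i j. 0 \<le> A $ i $ j"
  shows "A \<in> Q_matrices \<longleftrightarrow> (\<forall>i. 0 < A $ i $ i)"
proof
  assume Q: "A \<in> Q_matrices"
  show "\<forall>i. 0 < A $ i $ i"
  proof
    fix k
    \<comment> \<open>Away from \<open>k\<close> the slack \<open>A *v x + q\<close> is at least 1,
      so \<open>x\<close> is supported at \<open>k\<close>; a nonnegative slack at \<open>k\<close>
      then needs \<open>A $ k $ k > 0\<close>.\<close>
    define q :: "real^'n" where "q = (\<chi> i. if i = k then -1 else 1)"
    obtain x where x: "\<And>i. 0 \<le> x $ i" and y: "\<And>i. 0 \<le> (A *v x + q) $ i"
      and xy: "inner x (A *v x + q) = 0"
      using Q unfolding Q_matrices_def by blast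
    have "\<forall>i\<in>UNIV. x $ i * (A *v x + q) $ i = 0"
      using xy x y by (subst sum_nonneg_eq_0_iff[symmetric]) (simp_all add: inner_vec_def)
    moreover have "(A *v x + q) $ i > 0" if "i \<noteq> k" for i
      using that A x by (simp add: q_def matrix_vector_mult_def add_nonneg_pos sum_nonneg)
    ultimately have x0: "x $ i = 0" if "i \<noteq> k" for i
      using that by (metis less_irrefl mult_eq_0_iff UNIV_I)
    have "(A *v x) $ k = (\<Sum>j\<in>UNIV. if j = k then A $ k $ k * x $ k else 0)"
      by (simp only: matrix_vector_mult_def vec_lambda_beta, intro sum.cong) (auto simp: x0)
    then have "1 \<le> A $ k $ k * x $ k"
      using y[of k] by (simp add: q_def)
    then show "0 < A $ k $ k" using A by (metis less_le mult_zero_left not_one_le_zero)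
  qed
next
  assume d: "\<forall>i. 0 < A $ i $ i"
  obtain \<delta> where \<delta>: "\<delta> > 0" and
    cop: "\<And>s. (\<And>i. 0 \<le> s i) \<Longrightarrow> \<delta> * (\<Sum>i\<in>UNIV. s i)\<^sup>2 \<le> (\<Sum>i\<in>UNIV. \<Sum>j\<in>UNIV. A $ i $ j * s j * s i)"
    using positive_diagonal_copositive[OF A d] by blast
  define K :: "(real^'n) set" where "K = {x. \<forall>i. 0 \<le> x $ i}"
  have h: "inner 1 x = (\<Sum>i\<in>UNIV. x $ i)" for x :: "real^'n" by (simp add: inner_vec_def)
  show "A \<in> Q_matrices"
    unfolding Q_matrices_def
  proof (rule CollectI, rule allI)
    fix q :: "real^'n"
    have "closed K"
      unfolding K_def by (intro closed_Collect_all closed_Collect_le continuous_intros)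
    moreover have "convex K" "cone K" "K \<noteq> {}"
      by (auto simp: K_def convex_def cone_def intro: exI[of _ 0])
    \<comment> \<open>On the orthant \<open>inner 1 x\<close> is the l1 norm, which dominates the
      Euclidean norm; hence \<open>B = 1\<close>.\<close>
    moreover have "norm x \<le> 1 * inner 1 x" if "x \<in> K" for x
      using norm_le_l1_cart[of x] that by (simp add: h K_def)
    moreover have "0 \<le> inner 1 x" if "x \<in> K" for x
      using that by (simp add: h K_def sum_nonneg)
    moreover have "\<delta> * (inner 1 x)\<^sup>2 \<le> inner (A *v x) x" if "x \<in> K" for x
      using cop[of "\<lambda>i. x $ i"] that
      by (simp add: h K_def inner_vec_def matrix_vector_mult_def sum_distrib_right)
    ultimately obtain x where x: "x \<in> K" "\<And>z. z \<in> K \<Longrightarrow> 0 \<le> inner (A *v x + q) z"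
        "inner x (A *v x + q) = 0"
      using strictly_copositive_complementarity[of "(*v) A" K 1 1 \<delta> q] \<delta> matrix_vector_mul_linear
      by metis
    \<comment> \<open>Axis vectors lie in \<open>K\<close>, so membership in the dual cone reads off
      each coordinate.\<close>
    have "0 \<le> (A *v x + q) $ i" for i
      using x(2)[of "axis i 1"] unfolding inner_axis by (simp add: K_def axis_def)
    then show "\<exists>x. (\<forall>i. 0 \<le> x $ i) \<and> (\<forall>i. 0 \<le> (A *v x + q) $ i) \<and> inner x (A *v x + q) = 0"
      using x by (auto simp: K_def)
  qed
qed

section \<open>Linearized Jordan identity and multiplication by idempotents\<close>

context euclidean_jordan_algebra
begin

lemmas mul_simps = bilinear_ladd[OF bilinear_mul] bilinear_radd[OF bilinear_mul]
  bilinear_lmul[OF bilinear_mul] bilinear_rmul[OF bilinear_mul]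
  bilinear_lsub[OF bilinear_mul] bilinear_rsub[OF bilinear_mul]
  bilinear_lzero[OF bilinear_mul] bilinear_rzero[OF bilinear_mul]

lemma linear_mul: "linear (mul x)"
  using bilinear_mul by (simp add: bilinear_def)

lemma inner_mul': "inner (mul x y) z = inner y (mul x z)"
  using inner_mul[of y x z] by (simp add: mul_commute)

lemma inner_mul_self: "inner (mul x x) e = inner x x"
  using inner_mul[of x x e] by (simp add: mul_unit)

text \<open>Polarization: the Jordan identity at \<open>x + z\<close> and \<open>x - z\<close>,
  combined with those at \<open>x\<close> and \<open>z\<close>, isolates the part linear in
  \<open>z\<close>. Pairing with \<open>v\<close> reduces this to real linear arithmetic.\<close>

lemma jordan_linearized1:
  "mul z (mul (mul x x) y) + 2 *\<^sub>R mul x (mul (mul x z) y)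
    = mul (mul x x) (mul z y) + 2 *\<^sub>R mul (mul x z) (mul x y)"
proof (rule vector_eq_rdot[THEN iffD1], rule allI)
  fix v
  have p: "inner (mul (x + z) (mul (mul (x + z) (x + z)) y)) v =
      inner (mul (mul (x + z) (x + z)) (mul (x + z) y)) v"
    and m: "inner (mul (x - z) (mul (mul (x - z) (x - z)) y)) v =
      inner (mul (mul (x - z) (x - z)) (mul (x - z) y)) v"
    and x: "inner (mul x (mul (mul x x) y)) v = inner (mul (mul x x) (mul x y)) v"
    and z: "inner (mul z (mul (mul z z) y)) v = inner (mul (mul z z) (mul z y)) v"
    by (simp_all add: jordan_identity)
  show "inner (mul z (mul (mul x x) y) + 2 *\<^sub>R mul x (mul (mul x z) y)) v
    = inner (mul (mul x x) (mul z y) + 2 *\<^sub>R mul (mul x z) (mul x y)) v"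
    using p m x z
    by (simp add: mul_simps inner_add_left inner_diff_left mul_commute[of z x])
qed

text \<open>Second polarization: the instance of \<open>jordan_linearized1\<close> at
  \<open>x + w\<close> minus those at \<open>x\<close> and \<open>w\<close>, halved.\<close>

lemma jordan_linearized2:
  "mul z (mul (mul x w) y) + mul x (mul (mul w z) y) + mul w (mul (mul x z) y)
    = mul (mul x w) (mul z y) + mul (mul w z) (mul x y) + mul (mul x z) (mul w y)"
proof (rule vector_eq_rdot[THEN iffD1], rule allI)
  fix v
  show "inner (mul z (mul (mul x w) y) + mul x (mul (mul w z) y) + mul w (mul (mul x z) y)) v
    = inner (mul (mul x w) (mul z y) + mul (mul w z) (mul x y) + mul (mul x z) (mul w y)) v"
    using arg_cong[OF jordan_linearized1[of z "x + w" y], of "\<lambda>u. inner u v"]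
      arg_cong[OF jordan_linearized1[of z x y], of "\<lambda>u. inner u v"]
      arg_cong[OF jordan_linearized1[of z w y], of "\<lambda>u. inner u v"]
    by (simp add: mul_simps inner_add_left mul_commute[of w x])
qed

text \<open>Reading the linearized identity as an identity between operators applied to \<open>z\<close>.\<close>

lemma mul_mul_mul_eq:
  "mul (mul y (mul x w)) z = mul (mul x w) (mul y z) + mul (mul x y) (mul w z) + mul (mul w y) (mul x z)
    - mul x (mul y (mul w z)) - mul w (mul y (mul x z))"
  using jordan_linearized2[of z x w y]
  by (simp add: algebra_simps mul_commute[of "mul x w" y]
      mul_commute[of "mul y (mul x w)" z] mul_commute[of "mul w z" y] mul_commute[of "mul x z" y] mul_commute[of z y]
      mul_commute[of "mul w z" "mul x y"] mul_commute[of "mul x z" "mul w y"])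

text \<open>Multiplication by an idempotent satisfies \<open>2L\<^sup>3 - 3L\<^sup>2 + L = 0\<close>, so its spectrum lies in \<open>{0, 1/2, 1}\<close>,
  where \<open>L = L\<^sup>2 + 4(L - L\<^sup>2)\<^sup>2\<close>.\<close>

lemma inner_mul_idempotent_nonneg:
  assumes c: "mul c c = c"
  shows "0 \<le> inner (mul c z) z"
proof -
  have cube: "2 * inner (mul c (mul c (mul c z))) v = 3 * inner (mul c (mul c z)) v - inner (mul c z) v" for v
    using arg_cong[OF mul_mul_mul_eq[of c c c z], of "\<lambda>u. inner u v"]
    by (simp add: c inner_add_left inner_diff_left)
  \<comment> \<open>By self-adjointness \<open>inner a z\<close>, \<open>inner a a\<close>,
    \<open>inner b a\<close>, \<open>inner b b\<close> are the moments of \<open>mul c\<close> at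
    \<open>z\<close> of orders 1 to 4, and \<open>cube\<close> relates them.\<close>
  define a where "a = mul c z"
  define b where "b = mul c a"
  have "2 * inner b a = 3 * inner a a - inner a z" "2 * inner b b = 3 * inner b a - inner a a"
    using cube[of z] cube[of a] inner_mul'[of c a z] inner_mul'[of c b z] inner_mul'[of c b a]
    by (simp_all flip: a_def b_def)
  then have "inner a z = inner a a + 4 * inner (a - b) (a - b)"
    using inner_mul'[of c a z]
    by (simp add: inner_diff_left inner_diff_right inner_commute flip: a_def b_def)
  then show ?thesis by (simp add: a_def)
qed

lemma inner_square_idempotent_nonneg:
  assumes "mul c c = c"
  shows "0 \<le> inner (mul z z) c"
  using inner_mul_idempotent_nonneg[OF assms, of z] by (metis inner_mul inner_commute mul_commute)

section \<open>Power associativity\<close>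

text \<open>The power of exponent \<open>n + 1\<close>: the sequence starts at \<open>x\<close> and
  not at \<open>e\<close>.\<close>

definition pow :: "'a \<Rightarrow> nat \<Rightarrow> 'a" where
  "pow x n = (mul x ^^ n) x"

lemma pow_simps: "pow x 0 = x" "pow x (Suc n) = mul x (pow x n)"
  by (simp_all add: pow_def)

text \<open>By \<open>mul_mul_mul_eq\<close>, multiplication by a power is expressed through
  multiplication by \<open>x\<close>, by \<open>mul x x\<close> and by the two preceding powers, so
  commuting with the first two suffices.\<close>

lemma mul_pow_commute_aux:
  assumes M: "linear M" "\<And>z. M (mul x z) = mul x (M z)" "\<And>z. M (mul (mul x x) z) = mul (mul x x) (M z)"
  shows "M (mul (pow x n) z) = mul (pow x n) (M z)"
proof -
  \<comment> \<open>The recursion has depth two, so the induction carries consecutive powers;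
    \<open>pow x 1\<close> is \<open>mul x x\<close>.\<close>
  have "(\<forall>z. M (mul (pow x n) z) = mul (pow x n) (M z)) \<and>
    (\<forall>z. M (mul (pow x (Suc n)) z) = mul (pow x (Suc n)) (M z))"
  proof (induction n)
    case (Suc n)
    have "mul (pow x (Suc (Suc n))) z = mul (mul (pow x n) x) (mul x z) + mul (mul (pow x n) x) (mul x z)
        + mul (mul x x) (mul (pow x n) z) - mul (pow x n) (mul x (mul x z)) - mul x (mul x (mul (pow x n) z))" for z
      using mul_mul_mul_eq[of x "pow x n" x z] by (simp add: pow_simps mul_commute[of x "pow x n"])
    moreover have "mul (pow x n) x = pow x (Suc n)" by (simp add: pow_simps mul_commute)
    ultimately show ?case using Suc M
      by (simp add: linear_add linear_diff)
  qed (use M in \<open>simp add: pow_simps\<close>)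
  then show ?thesis by blast
qed

text \<open>The operators \<open>mul x\<close> and \<open>mul (mul x x)\<close> commute by the
  Jordan identity, so both commute with multiplication by any power; the latter can then itself take
  the role of \<open>M\<close>.\<close>

lemma mul_pow_commute: "mul (pow x m) (mul (pow x n) z) = mul (pow x n) (mul (pow x m) z)"
proof -
  have j: "mul x (mul (mul x x) z) = mul (mul x x) (mul x z)" for z
    by (rule jordan_identity)
  have "mul (pow x n) (mul x z) = mul x (mul (pow x n) z)" for n z
    using mul_pow_commute_aux[of "mul x" x n z] j linear_mul by simp
  moreover have "mul (pow x n) (mul (mul x x) z) = mul (mul x x) (mul (pow x n) z)" for n z
    using mul_pow_commute_aux[of "mul (mul x x)" x n z] j linear_mul by simp
  ultimately show ?thesis
    by (intro mul_pow_commute_aux linear_mul) auto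
qed

text \<open>Commutation moves one factor \<open>x\<close> to the front; \<open>Suc\<close> accounts
  for the exponent shift in \<open>pow\<close>.\<close>

lemma mul_pow_pow: "mul (pow x m) (pow x n) = pow x (Suc (m + n))"
proof (induction n)
  case 0
  then show ?case by (simp add: pow_simps mul_commute)
next
  case (Suc n)
  have "mul (pow x m) (pow x (Suc n)) = mul (pow x m) (mul (pow x 0) (pow x n))" by (simp add: pow_simps)
  also have "\<dots> = mul x (mul (pow x m) (pow x n))" by (subst mul_pow_commute) (simp add: pow_simps)
  finally show ?case using Suc by (simp add: pow_simps)
qed

section \<open>The subalgebra generated by one element\<close>

text \<open>Only positive powers are used, so that an idempotent annihilating \<open>x\<close>
  annihilates all of \<open>gen x\<close>.\<close>

definition gen :: "'a \<Rightarrow> 'a set" where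
  "gen x = span (range (pow x))"

lemma subspace_gen: "subspace (gen x)"
  by (simp add: gen_def)

lemma self_in_gen: "x \<in> gen x"
  unfolding gen_def by (metis pow_simps(1) rangeI span_base)

lemma gen_induct [consumes 1, case_names subspace pow]:
  assumes "u \<in> gen x" "subspace {u. P u}" "\<And>n. P (pow x n)"
  shows "P u"
  using assms unfolding gen_def by (metis (mono_tags, lifting) mem_Collect_eq rangeE span_induct)

lemma mul_gen:
  assumes "u \<in> gen x" "v \<in> gen x"
  shows "mul u v \<in> gen x"
  using assms(1)
proof (induction rule: gen_induct)
  case (pow n)
  show ?case using assms(2)
  proof (induction rule: gen_induct)
    case (pow m)
    then show ?case unfolding mul_pow_pow by (simp add: gen_def span_base)
  qed (auto simp: subspace_def mul_simps gen_def span_add span_scale span_zero)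
qed (auto simp: subspace_def mul_simps gen_def span_add span_scale span_zero)

text \<open>Trilinearity reduces associativity to powers, where \<open>mul_pow_pow\<close> settles
  it.\<close>

lemma mul_assoc_gen:
  assumes "u \<in> gen x" "v \<in> gen x" "w \<in> gen x"
  shows "mul (mul u v) w = mul u (mul v w)"
  using assms(1)
proof (induction rule: gen_induct)
  case (pow n)
  show ?case using assms(2)
  proof (induction rule: gen_induct)
    case (pow m)
    show ?case using assms(3)
    proof (induction rule: gen_induct)
      case (pow k)
      then show ?case by (simp add: mul_pow_pow add.assoc)
    qed (auto simp: subspace_def mul_simps)
  qed (auto simp: subspace_def mul_simps)
qed (auto simp: subspace_def mul_simps)

text \<open>An eigenvector \<open>u = p(x)\<close> of multiplication by \<open>x\<close> satisfies \<open>u\<^sup>2 = p(x)u = p(l)u\<close>,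
  hence is a multiple of an idempotent.\<close>

lemma idempotent_in_gen:
  assumes "x \<noteq> 0"
  obtains c l where "c \<in> gen x" "c \<noteq> 0" "mul c c = c" "mul x c = l *\<^sub>R c"
proof -
  have "gen x \<noteq> {0}" using assms self_in_gen[of x] by auto
  then obtain u l where u: "u \<in> gen x" "u \<noteq> 0" "mul x u = l *\<^sub>R u"
    using eigenvector_self_adjoint_on_subspace[of "mul x" "gen x"] linear_mul subspace_gen
      mul_gen[OF self_in_gen] inner_mul' by metis
  have "\<exists>m. mul v u = m *\<^sub>R u" if "v \<in> gen x" for v
    using that
  proof (induction rule: gen_induct)
    case subspace
    show ?case
      by (auto simp: subspace_def mul_simps simp flip: scaleR_left_distrib intro: exI[of _ 0])
  next
    case (pow n)
    show ?case
    proof (induction n)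
      case 0
      then show ?case using u by (auto simp: pow_simps)
    next
      case (Suc n)
      have "pow x n \<in> gen x" by (simp add: gen_def span_base)
      then have "mul (pow x (Suc n)) u = mul x (mul (pow x n) u)"
        using mul_assoc_gen[OF self_in_gen _ u(1)] by (simp add: pow_simps)
      then show ?case using Suc u by (auto simp: mul_simps)
    qed
  qed
  then obtain m where m: "mul u u = m *\<^sub>R u" using u by blast
  \<comment> \<open>If \<open>m\<close> were 0, the square of \<open>u\<close> would vanish, and its
    pairing with \<open>e\<close> is \<open>inner u u\<close>.\<close>
  have "m \<noteq> 0" using m inner_mul_self[of u] u by auto
  show ?thesis
  proof (rule that)
    show "u /\<^sub>R m \<in> gen x" using u subspace_gen by (simp add: subspace_scale)
    show "u /\<^sub>R m \<noteq> 0" using u \<open>m \<noteq> 0\<close> by simp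
    show "mul (u /\<^sub>R m) (u /\<^sub>R m) = u /\<^sub>R m" using m \<open>m \<noteq> 0\<close> by (simp add: mul_simps)
    show "mul x (u /\<^sub>R m) = l *\<^sub>R (u /\<^sub>R m)" using u by (simp add: mul_simps)
  qed
qed

section \<open>Spectral decomposition\<close>

text \<open>Splitting off one idempotent \<open>c\<close> leaves a remainder whose generated
  subalgebra is annihilated by \<open>c\<close> and hence smaller. The inclusion in
  \<open>gen x\<close> is what makes the remaining idempotents orthogonal to
  \<open>c\<close>.\<close>

lemma spectral_decomposition_gen:
  "\<exists>F ev. finite F \<and> F \<subseteq> gen x \<and> (\<forall>f\<in>F. mul f f = f) \<and> (\<forall>f\<in>F. \<forall>g\<in>F. f \<noteq> g \<longrightarrow> mul f g = 0)
     \<and> x = (\<Sum>f\<in>F. ev f *\<^sub>R f)"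
proof (induction "dim (gen x)" arbitrary: x rule: less_induct)
  case less
  show ?case
  proof (cases "x = 0")
    case True
    then show ?thesis by (intro exI[of _ "{}"]) simp
  next
    case False
    then obtain c l where c: "c \<in> gen x" "c \<noteq> 0" "mul c c = c" "mul x c = l *\<^sub>R c"
      using idempotent_in_gen by blast
    define x' where "x' = x - l *\<^sub>R c"
    define W where "W = {w \<in> gen x. mul w c = 0}"
    have x': "x' \<in> W"
      using c self_in_gen[of x] subspace_gen
      by (simp add: W_def x'_def mul_simps subspace_diff subspace_scale)
    have W: "subspace W"
      using subspace_gen[of x] by (auto simp: subspace_def W_def mul_simps)
    \<comment> \<open>Associativity inside \<open>gen x\<close> passes annihilation by
      \<open>c\<close> on to products.\<close>
    have "pow x' n \<in> W" for n
    proof (induction n)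
      case 0
      then show ?case using x' by (simp add: pow_simps)
    next
      case (Suc n)
      then show ?case using x' c mul_assoc_gen[of x' x "pow x' n" c]
        by (simp add: W_def pow_simps mul_gen mul_simps)
    qed
    then have sub: "gen x' \<subseteq> W"
      unfolding gen_def using W by (intro span_minimal) auto
    have "c \<notin> W" using c by (simp add: W_def)
    then have "gen x' \<subset> gen x" using sub c by (auto simp: W_def)
    then have "dim (gen x') < dim (gen x)"
      by (metis dim_psubset gen_def span_span)
    from less[OF this] obtain F ev where F: "finite F" "F \<subseteq> gen x'" "\<forall>f\<in>F. mul f f = f"
      "\<forall>f\<in>F. \<forall>g\<in>F. f \<noteq> g \<longrightarrow> mul f g = 0" "x' = (\<Sum>f\<in>F. ev f *\<^sub>R f)"
      by blast
    have FW: "F \<subseteq> W" using F sub by blast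
    have cF: "c \<notin> F" using FW \<open>c \<notin> W\<close> by blast
    have Fc: "mul f c = 0" "mul c f = 0" if "f \<in> F" for f
      using FW that mul_commute[of c f] by (auto simp: W_def)
    have "(\<Sum>f\<in>insert c F. (ev(c := l)) f *\<^sub>R f) = l *\<^sub>R c + (\<Sum>f\<in>F. (ev(c := l)) f *\<^sub>R f)"
      using cF F by simp
    also have "(\<Sum>f\<in>F. (ev(c := l)) f *\<^sub>R f) = x'"
      unfolding F(5) using cF by (intro sum.cong) auto
    finally have "x = (\<Sum>f\<in>insert c F. (ev(c := l)) f *\<^sub>R f)" by (simp add: x'_def)
    moreover have "insert c F \<subseteq> gen x" using FW c by (auto simp: W_def)
    moreover have "\<forall>f\<in>insert c F. \<forall>g\<in>insert c F. f \<noteq> g \<longrightarrow> mul f g = 0"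
      using F Fc by auto
    moreover have "\<forall>f\<in>insert c F. mul f f = f" "finite (insert c F)" using F c by auto
    ultimately show ?thesis by blast
  qed
qed

lemma spectral_decomposition:
  obtains F ev where "finite F" "\<And>f. f \<in> F \<Longrightarrow> mul f f = f"
    "\<And>f g. f \<in> F \<Longrightarrow> g \<in> F \<Longrightarrow> f \<noteq> g \<Longrightarrow> mul f g = 0" "x = (\<Sum>f\<in>F. ev f *\<^sub>R f)"
  using spectral_decomposition_gen[of x] by blast

lemma mul_orthogonal_sums:
  assumes F: "finite F" "\<And>f. f \<in> F \<Longrightarrow> mul f f = f"
    "\<And>f g. f \<in> F \<Longrightarrow> g \<in> F \<Longrightarrow> f \<noteq> g \<Longrightarrow> mul f g = 0"
  shows "mul (\<Sum>f\<in>F. a f *\<^sub>R f) (\<Sum>f\<in>F. b f *\<^sub>R f) = (\<Sum>f\<in>F. (a f * b f) *\<^sub>R f)"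
proof -
  have "mul (\<Sum>f\<in>F. a f *\<^sub>R f) (\<Sum>f\<in>F. b f *\<^sub>R f) = (\<Sum>f\<in>F. \<Sum>g\<in>F. mul (a f *\<^sub>R f) (b g *\<^sub>R g))"
    unfolding bilinear_sum[OF bilinear_mul] sum.cartesian_product ..
  also have "\<dots> = (\<Sum>f\<in>F. \<Sum>g\<in>F. if f = g then (a f * b f) *\<^sub>R f else 0)"
    using F by (intro sum.cong refl) (auto simp: mul_simps)
  also have "\<dots> = (\<Sum>f\<in>F. (a f * b f) *\<^sub>R f)"
    using F by simp
  finally show ?thesis .
qed

section \<open>Self-duality of the symmetric cone\<close>

lemma idempotent_in_symmetric_cone:
  assumes "mul c c = c"
  shows "c \<in> symmetric_cone mul"
  unfolding symmetric_cone_def using assms[symmetric] by blast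

text \<open>A square is a nonnegative combination of idempotents, each of which pairs nonnegatively
  with squares. Conversely, testing \<open>y\<close> against its own spectral idempotents gives
  nonnegative eigenvalues, whose square roots yield a root of \<open>y\<close>.\<close>

lemma symmetric_cone_self_dual:
  "y \<in> symmetric_cone mul \<longleftrightarrow> (\<forall>x \<in> symmetric_cone mul. 0 \<le> inner y x)"
proof
  assume "y \<in> symmetric_cone mul"
  then obtain z where y: "y = mul z z" by (auto simp: symmetric_cone_def)
  obtain F ev where F: "finite F" "\<And>f. f \<in> F \<Longrightarrow> mul f f = f"
    "\<And>f g. f \<in> F \<Longrightarrow> g \<in> F \<Longrightarrow> f \<noteq> g \<Longrightarrow> mul f g = 0" "z = (\<Sum>f\<in>F. ev f *\<^sub>R f)"
    using spectral_decomposition[of z] by blast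
  have y: "y = (\<Sum>f\<in>F. (ev f * ev f) *\<^sub>R f)"
    unfolding y F(4) using F(1-3) by (rule mul_orthogonal_sums)
  show "\<forall>x \<in> symmetric_cone mul. 0 \<le> inner y x"
  proof
    fix x assume "x \<in> symmetric_cone mul"
    then obtain w where x: "x = mul w w" by (auto simp: symmetric_cone_def)
    show "0 \<le> inner y x"
      unfolding y x inner_sum_left inner_scaleR_left
      using inner_square_idempotent_nonneg[OF F(2), of _ w]
      by (intro sum_nonneg mult_nonneg_nonneg[OF zero_le_square]) (simp add: inner_commute)
  qed
next
  assume d: "\<forall>x \<in> symmetric_cone mul. 0 \<le> inner y x"
  obtain F ev where F: "finite F" "\<And>f. f \<in> F \<Longrightarrow> mul f f = f"
    "\<And>f g. f \<in> F \<Longrightarrow> g \<in> F \<Longrightarrow> f \<noteq> g \<Longrightarrow> mul f g = 0" "y = (\<Sum>f\<in>F. ev f *\<^sub>R f)"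
    using spectral_decomposition[of y] by blast
  have ev: "0 \<le> ev f" if f: "f \<in> F" "f \<noteq> 0" for f
  proof -
    have "f \<in> symmetric_cone mul" by (rule idempotent_in_symmetric_cone[OF F(2)[OF f(1)]])
    then have "0 \<le> inner y f" using d by blast
    also have "inner y f = (\<Sum>g\<in>F. if g = f then ev f * inner f f else 0)"
      unfolding F(4) inner_sum_left
    proof (rule sum.cong)
      fix g assume g: "g \<in> F"
      have "inner g f = inner (mul g f) e" by (metis inner_mul mul_unit)
      then show "inner (ev g *\<^sub>R g) f = (if g = f then ev f * inner f f else 0)"
        using F(3)[OF g f(1)] by auto
    qed simp
    also have "\<dots> = ev f * inner f f" using F f by simp
    finally show ?thesis using f inner_gt_zero_iff[of f] by (simp add: zero_le_mult_iff del: inner_gt_zero_iff)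
  qed
  define z where "z = (\<Sum>f\<in>F. sqrt (ev f) *\<^sub>R f)"
  have "mul z z = (\<Sum>f\<in>F. (sqrt (ev f) * sqrt (ev f)) *\<^sub>R f)"
    unfolding z_def using F(1-3) by (rule mul_orthogonal_sums)
  also have "\<dots> = y"
    unfolding F(4)
  proof (rule sum.cong)
    \<comment> \<open>The coefficient of a possible \<open>f = 0\<close> in \<open>F\<close> may be
      negative, but that term vanishes.\<close>
    show "(sqrt (ev f) * sqrt (ev f)) *\<^sub>R f = ev f *\<^sub>R f" if "f \<in> F" for f
      using ev[OF that] by (cases "f = 0") simp_all
  qed simp
  finally show "y \<in> symmetric_cone mul" by (force simp: symmetric_cone_def)
qed

text \<open>As an intersection of closed half-spaces through 0, the symmetric cone is closed, convex
  and a cone.\<close>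

lemma symmetric_cone_eq_Inter:
  "symmetric_cone mul = (\<Inter>x\<in>symmetric_cone mul. {y. inner x y \<ge> 0})"
proof (rule set_eqI)
  show "y \<in> symmetric_cone mul \<longleftrightarrow> y \<in> (\<Inter>x\<in>symmetric_cone mul. {y. inner x y \<ge> 0})" for y
    by (subst symmetric_cone_self_dual) (simp add: inner_commute)
qed

lemma closed_symmetric_cone: "closed (symmetric_cone mul)"
  by (subst symmetric_cone_eq_Inter) (intro closed_INT ballI closed_halfspace_ge)

lemma convex_symmetric_cone: "convex (symmetric_cone mul)"
  by (subst symmetric_cone_eq_Inter) (intro convex_INT convex_halfspace_ge)

lemma cone_symmetric_cone: "cone (symmetric_cone mul)"
  by (subst symmetric_cone_eq_Inter) (auto simp: cone_def)

text \<open>For \<open>x = mul z z\<close> the pairing \<open>inner e x\<close> is the squared norm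
  of \<open>z\<close>, which bounds \<open>norm x\<close> by continuity of the product. Thus
  \<open>e\<close> can serve as the functional \<open>h\<close> that truncates the cone.\<close>

lemma norm_symmetric_cone_le:
  obtains B where "\<And>x. x \<in> symmetric_cone mul \<Longrightarrow> norm x \<le> B * inner e x"
proof -
  obtain B where B: "\<And>x y. norm (mul x y) \<le> B * norm x * norm y"
    using bilinear_bounded[OF bilinear_mul] by blast
  have "norm x \<le> B * inner e x" if "x \<in> symmetric_cone mul" for x
  proof -
    obtain z where z: "x = mul z z"
      using \<open>x \<in> symmetric_cone mul\<close> by (auto simp: symmetric_cone_def)
    then have "inner e x = norm z * norm z"
      by (simp add: inner_commute[of e] inner_mul_self norm_eq_sqrt_inner)
    then show ?thesis using B[of z z] z by (simp add: mult.assoc)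
  qed
  then show ?thesis using that by blast
qed

section \<open>Operators built on a Jordan frame\<close>

lemma linear_frame_operator: "linear (frame_operator c A)"
  by (rule linearI)
    (simp_all add: frame_operator_def outer_def inner_add_right sum.distrib scaleR_sum_right
      algebra_simps)

lemma inner_frame_operator:
  "inner (frame_operator c A x) x = (\<Sum>i\<in>UNIV. \<Sum>j\<in>UNIV. A $ i $ j * inner (c j) x * inner (c i) x)"
  by (simp add: frame_operator_def outer_def inner_sum_left mult.assoc)

lemma frame_operator_Q_iff:
  fixes c :: "'n::finite \<Rightarrow> 'a" and A :: "real^'n^'n"
  assumes "inj c" and "jordan_frame mul e (range c)" and A: "\<forall>i j. 0 \<le> A $ i $ j"
  shows "frame_operator c A \<in> Q_operators mul \<longleftrightarrow> (\<forall>i. 0 < A $ i $ i)"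
proof -
  let ?K = "symmetric_cone mul"
  have idem: "mul (c i) (c i) = c i" and nz: "c i \<noteq> 0" for i
    using assms by (auto simp: jordan_frame_def primitive_idempotent_def idempotent_def)
  have "mul (c i) (c j) = 0" if "i \<noteq> j" for i j
    using assms that by (auto simp: jordan_frame_def inj_eq)
  then have orth: "inner (c i) (c j) = 0" if "i \<noteq> j" for i j
    using that by (metis inner_mul mul_unit inner_zero_left)
  have e: "e = (\<Sum>i\<in>UNIV. c i)"
    using assms by (simp add: jordan_frame_def sum.reindex)
  have cK: "c i \<in> ?K" for i by (rule idempotent_in_symmetric_cone[OF idem])
  have pos: "0 \<le> inner (c i) x" if "x \<in> ?K" for x i
    using symmetric_cone_self_dual[of x] that cK by (metis inner_commute)
  show ?thesis
  proof
    assume Q: "frame_operator c A \<in> Q_operators mul"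
    show "\<forall>i. 0 < A $ i $ i"
    proof
      fix k
      define q where "q = (\<Sum>i\<in>UNIV. (if i = k then -1 else 1) *\<^sub>R c i)"
      obtain x where x: "x \<in> ?K" and yK: "frame_operator c A x + q \<in> ?K"
        and xy: "inner x (frame_operator c A x + q) = 0"
        using Q unfolding Q_operators_def lcp_solution_def by blast
      \<comment> \<open>The coefficients of the slack along the frame, playing the role of the
        coordinates of \<open>A *v x + q\<close>.\<close>
      define y where "y i = (\<Sum>j\<in>UNIV. A $ i $ j * inner (c j) x) + (if i = k then -1 else 1)" for i
      have y: "frame_operator c A x + q = (\<Sum>i\<in>UNIV. y i *\<^sub>R c i)"
        by (simp add: frame_operator_def outer_def q_def y_def sum.distrib scaleR_left_distrib
            scaleR_sum_left flip: sum.distrib)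
      have "inner (c i) (\<Sum>i\<in>UNIV. y i *\<^sub>R c i) = y i * inner (c i) (c i)" for i
      proof -
        have "inner (c i) (\<Sum>j\<in>UNIV. y j *\<^sub>R c j) = (\<Sum>j\<in>UNIV. if j = i then y i * inner (c i) (c i) else 0)"
          unfolding inner_sum_right inner_scaleR_right by (intro sum.cong) (auto simp: orth)
        then show ?thesis by simp
      qed
      \<comment> \<open>Pairing with \<open>c i\<close> recovers \<open>y i\<close> up to the
        positive factor \<open>inner (c i) (c i)\<close>, enough for its sign.\<close>
      then have ypos: "0 \<le> y i" for i
        using pos[OF yK, of i] nz[of i] inner_gt_zero_iff[of "c i"] unfolding y
        by (simp add: zero_le_mult_iff del: inner_gt_zero_iff)
      have "(\<Sum>i\<in>UNIV. y i * inner (c i) x) = 0"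
        using xy unfolding y by (simp add: inner_sum_right inner_commute)
      then have "\<forall>i\<in>UNIV. y i * inner (c i) x = 0"
        using ypos pos[OF x] by (subst sum_nonneg_eq_0_iff[symmetric]) simp_all
      moreover have "y i > 0" if "i \<noteq> k" for i
        using that A pos[OF x] by (simp add: y_def add_nonneg_pos sum_nonneg)
      ultimately have x0: "inner (c i) x = 0" if "i \<noteq> k" for i
        using that by (metis less_irrefl mult_eq_0_iff UNIV_I)
      have "(\<Sum>j\<in>UNIV. A $ k $ j * inner (c j) x)
          = (\<Sum>j\<in>UNIV. if j = k then A $ k $ k * inner (c k) x else 0)"
        by (intro sum.cong) (auto simp: x0)
      then have "1 \<le> A $ k $ k * inner (c k) x"
        using ypos[of k] by (simp add: y_def)
      then show "0 < A $ k $ k" using A by (metis less_le mult_zero_left not_one_le_zero)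
    qed
  next
    assume d: "\<forall>i. 0 < A $ i $ i"
    obtain \<delta> where \<delta>: "\<delta> > 0" and
      cop: "\<And>s. (\<And>i. 0 \<le> s i) \<Longrightarrow> \<delta> * (\<Sum>i\<in>UNIV. s i)\<^sup>2 \<le> (\<Sum>i\<in>UNIV. \<Sum>j\<in>UNIV. A $ i $ j * s j * s i)"
      using positive_diagonal_copositive[OF A d] by blast
    obtain B where B: "\<And>x. x \<in> ?K \<Longrightarrow> norm x \<le> B * inner e x"
      using norm_symmetric_cone_le by blast
    have e_pos: "0 \<le> inner e x" if "x \<in> ?K" for x
      unfolding e inner_sum_left using pos[OF that] by (simp add: sum_nonneg)
    have cop': "\<delta> * (inner e x)\<^sup>2 \<le> inner (frame_operator c A x) x" if "x \<in> ?K" for x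
      unfolding e inner_sum_left inner_frame_operator using pos[OF that] by (intro cop)
    have "\<exists>x. lcp_solution (frame_operator c A) ?K q x" for q
    proof -
      have "?K \<noteq> {}" using cK by blast
      then obtain x where "x \<in> ?K" "\<And>z. z \<in> ?K \<Longrightarrow> 0 \<le> inner (frame_operator c A x + q) z"
        "inner x (frame_operator c A x + q) = 0"
        using strictly_copositive_complementarity[OF linear_frame_operator closed_symmetric_cone
            convex_symmetric_cone cone_symmetric_cone _ B e_pos cop' \<delta>, of q] by blast
      \<comment> \<open>The slack is so far only known to lie in the dual cone; self-duality puts it
        in the cone.\<close>
      then show ?thesis
        unfolding lcp_solution_def using symmetric_cone_self_dual by blast
    qed
    then show "frame_operator c A \<in> Q_operators mul"
      by (simp add: Q_operators_def linear_frame_operator)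
  qed
qed

end

theorem theorem10p5:
  fixes mul :: "'a::euclidean_space \<Rightarrow> 'a \<Rightarrow> 'a" and e :: 'a
    and c :: "'n::finite \<Rightarrow> 'a" and A :: "real^'n^'n"
  assumes "euclidean_jordan_algebra mul e"
    and "\<forall>x y. inner x y = jordan_trace mul e (mul x y)"
    and "jordan_rank mul e = CARD('n)"
    and "inj c" and "jordan_frame mul e (range c)"
    and "\<forall>i j. 0 \<le> A $ i $ j"
  shows "(frame_operator c A \<in> Q_operators mul \<longleftrightarrow> (\<forall>i. 0 < A $ i $ i)) \<and>
         (frame_operator c A \<in> Q_operators mul \<longleftrightarrow> A \<in> Q_matrices)"
  using euclidean_jordan_algebra.frame_operator_Q_iff[OF assms(1,4,5,6)]
    nonneg_Q_matrices_iff[OF assms(6)] by blast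

end
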